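(* Let $p\geq 3$ be a prime and $H_p$ the Heisenberg group over $\mathbb Z_p$ (presented as $\{x^ay^bz^c:0\le a,b,c<p\}$ with $x^p=y^p=z^p=1$, $xz=zx$, $yz=zy$, $yx=xyz$). For any $a\in\mathbb N$ with $p\nmid a$ and any $m\in\mathbb Z$ there is $F=\sum_{0\le i,j,k<p}a_{ijk}x^iy^jz^k$ with $a_{ijk}\in\mathbb Z$ such that $M_{H_p}(F)=a^{p^2}+mp^3$.
   Context: $M_{H_p}(F)=\det(a_{gh^{-1}})_{g,h\in H_p}$ is the group determinant of $H_p$ evaluated at the coefficients of $F$, where $a_g=a_{ijk}$ for $g=x^iy^jz^k$. *)

theory Defs
  imports
    "HOL-Algebra.Group"
    "HOL-Computational_Algebra.Primes"
    "Jordan_Normal_Form.Determinant"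
begin

(* The matrix determinant is indexed by natural numbers, so the rows and columns are
   labelled through a bijection from {0..<|G|} to the carrier. The choice does not
   matter; see group_det_enum. The value is meaningful for finite G only. *)
definition group_det :: "('g, 'm) monoid_scheme \<Rightarrow> ('g \<Rightarrow> 'r::comm_ring_1) \<Rightarrow> 'r" where
  "group_det G f =
    (let n = card (carrier G); e = (SOME e. bij_betw e {0..<n} (carrier G))
     in det (mat n n (\<lambda>(i, j). f (e i \<otimes>\<^bsub>G\<^esub> inv\<^bsub>G\<^esub> (e j)))))"

lemma det_relabel:
  fixes A :: "nat \<Rightarrow> nat \<Rightarrow> 'r::comm_ring_1"
  assumes p: "p permutes {0..<n}"
  shows "det (mat n n (\<lambda>(i, j). A (p i) (p j))) = det (mat n n (\<lambda>(i, j). A i j))"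
proof -
  have lt: "p i < n" if "i < n" for i
    using permutes_in_image[OF p, of i] that by simp
  have rows: "det (mat n n (\<lambda>(i, j). B (p i) j)) = signof p * det (mat n n (\<lambda>(i, j). B i j))"
    for B :: "nat \<Rightarrow> nat \<Rightarrow> 'r"
  proof -
    have "mat n n (\<lambda>(i, j). mat n n (\<lambda>(i, j). B i j) $$ (p i, j)) = mat n n (\<lambda>(i, j). B (p i) j)"
      by (rule eq_matI) (auto simp: lt)
    then show ?thesis
      using det_permute_rows[OF mat_carrier[of n n "\<lambda>(i, j). B i j"] p] by simp
  qed
  have tr: "det (mat n n (\<lambda>(i, j). B j i)) = det (mat n n (\<lambda>(i, j). B i j))"
    for B :: "nat \<Rightarrow> nat \<Rightarrow> 'r"
  proof -
    have "transpose_mat (mat n n (\<lambda>(i, j). B i j)) = mat n n (\<lambda>(i, j). B j i)"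
      by (rule eq_matI) auto
    then show ?thesis
      using det_transpose[OF mat_carrier[of n n "\<lambda>(i, j). B i j"]] by simp
  qed
  have "det (mat n n (\<lambda>(i, j). A (p i) (p j))) = signof p * det (mat n n (\<lambda>(i, j). A i (p j)))"
    by (rule rows)
  also have "det (mat n n (\<lambda>(i, j). A i (p j))) = det (mat n n (\<lambda>(i, j). A j (p i)))"
    by (rule tr[symmetric])
  also have "\<dots> = signof p * det (mat n n (\<lambda>(i, j). A j i))"
    by (rule rows)
  also have "det (mat n n (\<lambda>(i, j). A j i)) = det (mat n n (\<lambda>(i, j). A i j))"
    by (rule tr)
  finally show ?thesis
    by (simp add: mult.assoc[symmetric] sign_def)
qed

lemma group_det_enum:
  assumes "bij_betw e {0..<card (carrier G)} (carrier G)"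
  shows "group_det G f =
    det (mat (card (carrier G)) (card (carrier G)) (\<lambda>(i, j). f (e i \<otimes>\<^bsub>G\<^esub> inv\<^bsub>G\<^esub> (e j))))"
proof -
  define n where "n = card (carrier G)"
  define e' where "e' = (SOME e. bij_betw e {0..<n} (carrier G))"
  have e: "bij_betw e {0..<n} (carrier G)" using assms by (simp add: n_def)
  then have e': "bij_betw e' {0..<n} (carrier G)"
    unfolding e'_def by (rule someI[of "\<lambda>e. bij_betw e {0..<n} (carrier G)"])
  define q where "q i = (if i \<in> {0..<n} then inv_into {0..<n} e (e' i) else i)" for i
  have "bij_betw (inv_into {0..<n} e \<circ> e') {0..<n} {0..<n}"
    using e' bij_betw_inv_into[OF e] by (rule bij_betw_trans)
  then have "bij_betw q {0..<n} {0..<n}"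
    by (rule bij_betw_cong[THEN iffD1, rotated]) (simp add: q_def)
  then have q: "q permutes {0..<n}"
    by (rule bij_imp_permutes) (auto simp: q_def)
  have eq: "e (q i) = e' i" if "i < n" for i
    using that bij_betw_inv_into_right[OF e, of "e' i"] bij_betwE[OF e'] by (simp add: q_def)
  have "mat n n (\<lambda>(i, j). f (e' i \<otimes>\<^bsub>G\<^esub> inv\<^bsub>G\<^esub> (e' j)))
      = mat n n (\<lambda>(i, j). f (e (q i) \<otimes>\<^bsub>G\<^esub> inv\<^bsub>G\<^esub> (e (q j))))"
    by (rule eq_matI) (auto simp: eq)
  then have "group_det G f = det (mat n n (\<lambda>(i, j). f (e (q i) \<otimes>\<^bsub>G\<^esub> inv\<^bsub>G\<^esub> (e (q j)))))"
    by (simp add: group_det_def n_def e'_def Let_def)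
  also have "\<dots> = det (mat n n (\<lambda>(i, j). f (e i \<otimes>\<^bsub>G\<^esub> inv\<^bsub>G\<^esub> (e j))))"
    by (rule det_relabel[OF q, of "\<lambda>i j. f (e i \<otimes>\<^bsub>G\<^esub> inv\<^bsub>G\<^esub> (e j))"])
  finally show ?thesis by (simp add: n_def)
qed

(* The triple (a, b, c) stands for x^a y^b z^c. Since y x = x y z with z central,
   y^b x^a' = x^a' y^b z^(a' b), which gives the term a' b below. *)
definition heisenberg :: "nat \<Rightarrow> (nat \<times> nat \<times> nat) monoid" where
  "heisenberg p =
    \<lparr>carrier = {..<p} \<times> {..<p} \<times> {..<p},
     mult = (\<lambda>(a, b, c) (a', b', c').
       ((a + a') mod p, (b + b') mod p, (c + c' + a' * b) mod p)),
     one = (0, 0, 0)\<rparr>"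

definition heis_x :: "nat \<times> nat \<times> nat" where "heis_x = (1, 0, 0)"
definition heis_y :: "nat \<times> nat \<times> nat" where "heis_y = (0, 1, 0)"
definition heis_z :: "nat \<times> nat \<times> nat" where "heis_z = (0, 0, 1)"

(* An element of the integral group ring is represented by its coefficient function. *)
definition heis_elem :: "nat \<Rightarrow> (nat \<Rightarrow> nat \<Rightarrow> nat \<Rightarrow> int) \<Rightarrow> nat \<times> nat \<times> nat \<Rightarrow> int" where
  "heis_elem p A g =
    (\<Sum>i<p. \<Sum>j<p. \<Sum>k<p.
      if heis_x [^]\<^bsub>heisenberg p\<^esub> i \<otimes>\<^bsub>heisenberg p\<^esub> heis_y [^]\<^bsub>heisenberg p\<^esub> j
           \<otimes>\<^bsub>heisenberg p\<^esub> heis_z [^]\<^bsub>heisenberg p\<^esub> k = g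
      then A i j k else 0)"

lemma heisenberg_sel:
  "carrier (heisenberg p) = {..<p} \<times> {..<p} \<times> {..<p}"
  "(a, b, c) \<otimes>\<^bsub>heisenberg p\<^esub> (a', b', c') =
    ((a + a') mod p, (b + b') mod p, (c + c' + a' * b) mod p)"
  "\<one>\<^bsub>heisenberg p\<^esub> = (0, 0, 0)"
  by (simp_all add: heisenberg_def)

lemma card_heisenberg: "card (carrier (heisenberg p)) = p ^ 3"
  by (simp add: heisenberg_sel card_cartesian_product power3_eq_cube)

lemma group_heisenberg:
  assumes "p > 0"
  shows "group (heisenberg p)"
proof (rule groupI)
  fix u assume u: "u \<in> carrier (heisenberg p)"
  obtain a b c where abc: "u = (a, b, c)" by (cases u)
  define v where "v = ((p - a) mod p, (p - b) mod p, (p - (c + a * ((p - b) mod p)) mod p) mod p)"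
  have lt: "a < p" "b < p" "c < p" using u by (auto simp: abc heisenberg_sel)
  have m: "(p - x mod p + x) mod p = 0" for x :: nat
  proof -
    have "(p - x mod p + x) mod p = (p - x mod p + x mod p) mod p" by (simp add: mod_simps)
    also have "\<dots> = 0" using assms by simp
    finally show ?thesis .
  qed
  have "((p - (c + a * ((p - b) mod p)) mod p) mod p + c + a * ((p - b) mod p)) mod p = 0"
    using m[of "c + a * ((p - b) mod p)"] by (simp add: mod_add_left_eq add.assoc)
  then have "v \<otimes>\<^bsub>heisenberg p\<^esub> u = \<one>\<^bsub>heisenberg p\<^esub>"
    using lt by (simp add: v_def abc heisenberg_sel mod_add_left_eq)
  moreover have "v \<in> carrier (heisenberg p)"
    using assms by (simp add: v_def heisenberg_sel)
  ultimately show "\<exists>v\<in>carrier (heisenberg p). v \<otimes>\<^bsub>heisenberg p\<^esub> u = \<one>\<^bsub>heisenberg p\<^esub>"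
    by blast
next
  fix u v w :: "nat \<times> nat \<times> nat"
  obtain a b c where u: "u = (a, b, c)" by (cases u)
  obtain a' b' c' where v: "v = (a', b', c')" by (cases v)
  obtain a'' b'' c'' where w: "w = (a'', b'', c'')" by (cases w)
  have "((c + c' + a' * b) mod p + c'' + a'' * ((b + b') mod p)) mod p
      = (c + c' + a' * b + c'' + a'' * (b + b')) mod p"
    by (intro mod_add_cong mod_mult_cong refl mod_mod_trivial)
  also have "c + c' + a' * b + c'' + a'' * (b + b') = c + (c' + c'' + a'' * b') + (a' + a'') * b"
    by (simp add: algebra_simps)
  also have "\<dots> mod p = (c + (c' + c'' + a'' * b') mod p + (a' + a'') mod p * b) mod p"
    by (intro mod_add_cong mod_mult_cong refl mod_mod_trivial[symmetric])
  finally show "u \<otimes>\<^bsub>heisenberg p\<^esub> v \<otimes>\<^bsub>heisenberg p\<^esub> w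
      = u \<otimes>\<^bsub>heisenberg p\<^esub> (v \<otimes>\<^bsub>heisenberg p\<^esub> w)"
    by (simp add: u v w heisenberg_sel mod_add_left_eq mod_add_right_eq add.assoc)
qed (use assms in \<open>auto simp: heisenberg_sel\<close>)

lemma heis_pow:
  assumes "p > 1"
  shows "heis_x [^]\<^bsub>heisenberg p\<^esub> (n::nat) = (n mod p, 0, 0)"
    and "heis_y [^]\<^bsub>heisenberg p\<^esub> n = (0, n mod p, 0)"
    and "heis_z [^]\<^bsub>heisenberg p\<^esub> n = (0, 0, n mod p)"
proof -
  have *: "u [^]\<^bsub>heisenberg p\<^esub> (0::nat) = \<one>\<^bsub>heisenberg p\<^esub>"
    "u [^]\<^bsub>heisenberg p\<^esub> Suc k = u [^]\<^bsub>heisenberg p\<^esub> k \<otimes>\<^bsub>heisenberg p\<^esub> u" for u k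
    by (simp_all add: nat_pow_def)
  show "heis_x [^]\<^bsub>heisenberg p\<^esub> n = (n mod p, 0, 0)"
    "heis_y [^]\<^bsub>heisenberg p\<^esub> n = (0, n mod p, 0)"
    "heis_z [^]\<^bsub>heisenberg p\<^esub> n = (0, 0, n mod p)"
    using assms
    by (induction n) (simp_all add: * heis_x_def heis_y_def heis_z_def heisenberg_sel mod_simps)
qed

lemma heisenberg_relations:
  assumes "p > 1"
  shows "heis_x \<in> carrier (heisenberg p)" "heis_y \<in> carrier (heisenberg p)"
    "heis_z \<in> carrier (heisenberg p)"
    "heis_x [^]\<^bsub>heisenberg p\<^esub> p = \<one>\<^bsub>heisenberg p\<^esub>"
    "heis_y [^]\<^bsub>heisenberg p\<^esub> p = \<one>\<^bsub>heisenberg p\<^esub>"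
    "heis_z [^]\<^bsub>heisenberg p\<^esub> p = \<one>\<^bsub>heisenberg p\<^esub>"
    "heis_x \<otimes>\<^bsub>heisenberg p\<^esub> heis_z = heis_z \<otimes>\<^bsub>heisenberg p\<^esub> heis_x"
    "heis_y \<otimes>\<^bsub>heisenberg p\<^esub> heis_z = heis_z \<otimes>\<^bsub>heisenberg p\<^esub> heis_y"
    "heis_y \<otimes>\<^bsub>heisenberg p\<^esub> heis_x = heis_x \<otimes>\<^bsub>heisenberg p\<^esub> heis_y \<otimes>\<^bsub>heisenberg p\<^esub> heis_z"
  using assms heis_pow[OF assms, of p]
  by (simp_all add: heis_x_def heis_y_def heis_z_def heisenberg_sel)

lemma heis_normal_form:
  assumes "i < p" "j < p" "k < p" "p > 1"
  shows "heis_x [^]\<^bsub>heisenberg p\<^esub> i \<otimes>\<^bsub>heisenberg p\<^esub> heis_y [^]\<^bsub>heisenberg p\<^esub> j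
           \<otimes>\<^bsub>heisenberg p\<^esub> heis_z [^]\<^bsub>heisenberg p\<^esub> k = (i, j, k)"
  using assms by (simp add: heis_pow heisenberg_sel)

lemma heis_elem_apply:
  assumes "i < p" "j < p" "k < p" "p > 1"
  shows "heis_elem p A (i, j, k) = A i j k"
proof -
  have "heis_elem p A (i, j, k) =
      (\<Sum>i'<p. \<Sum>j'<p. \<Sum>k'<p. if (i', j', k') = (i, j, k) then A i' j' k' else 0)"
    unfolding heis_elem_def
    by (intro sum.cong refl) (use assms in \<open>simp add: heis_normal_form\<close>)
  also have "\<dots> = (\<Sum>i'<p. if i' = i then \<Sum>j'<p. if j' = j then A i j k else 0 else 0)"
  proof (intro sum.cong refl)
    fix i'
    have "(\<Sum>k'<p. if (i', j', k') = (i, j, k) then A i' j' k' else 0) =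
        (if i' = i then if j' = j then A i j k else 0 else 0)" for j'
      using assms by (cases "i' = i"; cases "j' = j") simp_all
    then show "(\<Sum>j'<p. \<Sum>k'<p. if (i', j', k') = (i, j, k) then A i' j' k' else 0) =
        (if i' = i then \<Sum>j'<p. if j' = j then A i j k else 0 else 0)"
      by simp
  qed
  also have "\<dots> = A i j k"
    using assms by simp
  finally show ?thesis .
qed

end

theory Submission
  imports Defs "HOL-Algebra.Coset" "HOL-Library.Poly_Mapping" "HOL-Library.Product_Plus"
    "HOL-Number_Theory.Cong"
begin

text \<open>
  Let \<open>h : G \<rightarrow> H\<close> be surjective with kernel of order \<open>r\<close>, and let \<open>u\<close> be an element of the group
  ring of \<open>G\<close> that maps to the scalar \<open>a\<close> in the group ring of \<open>H\<close>. Sylvester's identity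
  \<open>det (a + BC) \<sim> det (a + CB)\<close> gives
  \<open>a ^ |H| * M\<^sub>G (u + w \<circ> h) = M\<^sub>G u * M\<^sub>H (a + r * w)\<close>.
  If the kernel is generated by \<open>z\<close> and \<open>u = 1 + z + \<dots> + z ^ (a - 1)\<close> with \<open>a\<close> coprime to \<open>r\<close>,
  then \<open>M\<^sub>G u = \<plusminus> a ^ |H|\<close>, because \<open>u\<close> is invertible up to the norm element of the kernel. Hence
  \<open>M\<^sub>G (u + w \<circ> h) = \<plusminus> M\<^sub>H (a + r * w)\<close>.

  If \<open>r = p\<close> is prime, \<open>H\<close> is abelian of exponent \<open>p\<close> and \<open>f\<close> has coefficient sum \<open>a\<close>, then
  \<open>f ^ p\<close> is of the form \<open>a + p * w\<close>. So if some \<open>f\<close> on \<open>H\<close> has coefficient sum \<open>a\<close> and determinant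
  \<open>\<plusminus> a\<close> (all nontrivial representations contribute a unit), then some element for \<open>G\<close> has both
  equal to \<open>a ^ p\<close> up to sign. Climbing from \<open>Z\<^sub>p\<close> through \<open>Z\<^sub>p\<^sup>2\<close> to the Heisenberg group yields
  \<open>a ^ (p ^ 2)\<close>. Adding \<open>m\<close> to all coefficients only affects the trivial representation, and turns
  \<open>\<plusminus> a ^ (p ^ 2)\<close> into \<open>\<plusminus> (a ^ (p ^ 2) + m * p ^ 3)\<close>; the sign is removed by negating the element,
  as the group has odd order.
\<close>

section \<open>Group determinants and convolution\<close>

lemma (in group) l_cancel_inv:
  assumes "x \<in> carrier G" "y \<in> carrier G"
  shows "inv x \<otimes> (x \<otimes> y) = y"
  using assms by (simp flip: m_assoc)

lemma (in group) r_cancel_inv: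
  assumes "x \<in> carrier G" "y \<in> carrier G"
  shows "x \<otimes> (inv x \<otimes> y) = y"
  using assms by (simp flip: m_assoc)

lemma (in group) mult_inv_eq_one_iff:
  assumes "x \<in> carrier G" "y \<in> carrier G"
  shows "x \<otimes> inv y = \<one> \<longleftrightarrow> x = y"
  using assms inv_equality[of x "inv y"] by auto

lemma group_det_cong:
  fixes G (structure)
  assumes "group G" "finite (carrier G)"
    and "\<And>x. x \<in> carrier G \<Longrightarrow> f x = h x"
  shows "group_det G f = group_det G h"
proof -
  interpret group G by fact
  obtain e where e: "bij_betw e {0..<card (carrier G)} (carrier G)"
    using ex_bij_betw_nat_finite[OF assms(2)] by blast
  have "e i \<in> carrier G" if "i < card (carrier G)" for i
    using bij_betwE[OF e] that by simp
  then show ?thesis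
    unfolding group_det_enum[OF e]
    by (intro arg_cong[where f = det] eq_matI) (auto simp: assms(3))
qed

lemma group_det_uminus:
  fixes f :: "'g \<Rightarrow> int"
  assumes "finite (carrier G)"
  shows "group_det G (\<lambda>x. - f x) = (-1) ^ card (carrier G) * group_det G f"
proof -
  obtain e where e: "bij_betw e {0..<card (carrier G)} (carrier G)"
    using ex_bij_betw_nat_finite[OF assms] by blast
  define n where "n = card (carrier G)"
  define A where "A = mat n n (\<lambda>(i, j). f (e i \<otimes>\<^bsub>G\<^esub> inv\<^bsub>G\<^esub> (e j)))"
  have "mat n n (\<lambda>(i, j). - f (e i \<otimes>\<^bsub>G\<^esub> inv\<^bsub>G\<^esub> (e j))) = (-1) \<cdot>\<^sub>m A"
    unfolding A_def by (rule eq_matI) auto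
  then show ?thesis
    unfolding group_det_enum[OF e] n_def[symmetric] by (simp add: A_def)
qed

lemma group_det_scalar:
  fixes G (structure)
  assumes "group G" "finite (carrier G)"
  shows "group_det G (\<lambda>x. if x = \<one>\<^bsub>G\<^esub> then a else 0) = a ^ card (carrier G)"
proof -
  interpret group G by fact
  obtain e where e: "bij_betw e {0..<card (carrier G)} (carrier G)"
    using ex_bij_betw_nat_finite[OF assms(2)] by blast
  define n where "n = card (carrier G)"
  have ec: "e i \<in> carrier G" if "i < n" for i
    using bij_betwE[OF e] that by (simp add: n_def)
  have "e i \<otimes> inv (e j) = \<one> \<longleftrightarrow> i = j" if "i < n" "j < n" for i j
    using bij_betw_imp_inj_on[OF e] that
    by (auto simp: inj_on_def n_def mult_inv_eq_one_iff ec)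
  then have "mat n n (\<lambda>(i, j). if e i \<otimes> inv (e j) = \<one> then a else 0) = a \<cdot>\<^sub>m 1\<^sub>m n"
    by (intro eq_matI) auto
  then show ?thesis
    unfolding group_det_enum[OF e] n_def[symmetric] by simp
qed

text \<open>The product of the group ring, written with the quotient g k^-1 that also indexes the
  entries of the group matrix.\<close>

definition convolution :: "('g, 'm) monoid_scheme \<Rightarrow> ('g \<Rightarrow> 'r::comm_ring_1) \<Rightarrow> ('g \<Rightarrow> 'r) \<Rightarrow> 'g \<Rightarrow> 'r" where
  "convolution G f h g = (\<Sum>k\<in>carrier G. f (g \<otimes>\<^bsub>G\<^esub> inv\<^bsub>G\<^esub> k) * h k)"

lemma (in group) sum_mult_right:
  assumes "g \<in> carrier G"
  shows "(\<Sum>k\<in>carrier G. f (k \<otimes> g)) = (\<Sum>k\<in>carrier G. f k)"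
  by (rule sum.reindex_bij_witness[of _ "\<lambda>k. k \<otimes> inv g" "\<lambda>k. k \<otimes> g"])
    (use assms in \<open>auto simp: m_assoc\<close>)

text \<open>The group matrix of \<open>f\<close> represents left multiplication by \<open>f\<close>.
  Concretely, replacing k by k (e j)^-1 turns a coefficient of the product into an entry of the
  matrix product.\<close>

lemma group_det_convolution:
  fixes G (structure)
  assumes "group G" "finite (carrier G)"
  shows "group_det G (convolution G f h) = group_det G f * group_det G h"
proof -
  interpret group G by fact
  obtain e where e: "bij_betw e {0..<card (carrier G)} (carrier G)"
    using ex_bij_betw_nat_finite[OF assms(2)] by blast
  define n where "n = card (carrier G)"
  have ec: "e i \<in> carrier G" if "i < n" for i
    using bij_betwE[OF e] that by (simp add: n_def)
  define A where "A u = mat n n (\<lambda>(i, j). u (e i \<otimes> inv (e j)))" for u :: "'a \<Rightarrow> 'c"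
  have entry: "convolution G f h (e i \<otimes> inv (e j)) =
      (\<Sum>k<n. f (e i \<otimes> inv (e k)) * h (e k \<otimes> inv (e j)))" if "i < n" "j < n" for i j
  proof -
    have "convolution G f h (e i \<otimes> inv (e j)) =
        (\<Sum>k\<in>carrier G. f (e i \<otimes> inv (e j) \<otimes> inv (k \<otimes> inv (e j))) * h (k \<otimes> inv (e j)))"
      unfolding convolution_def
      by (rule sum_mult_right[symmetric,
            where f = "\<lambda>k. f (e i \<otimes> inv (e j) \<otimes> inv k) * h k"]) (use that ec in simp)
    also have "\<dots> = (\<Sum>k\<in>carrier G. f (e i \<otimes> inv k) * h (k \<otimes> inv (e j)))"
    proof (intro sum.cong refl)
      fix k assume k: "k \<in> carrier G"
      have "e i \<otimes> inv (e j) \<otimes> inv (k \<otimes> inv (e j)) = e i \<otimes> inv k"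
        using k ec that by (simp add: inv_mult_group m_assoc l_cancel_inv)
      then show "f (e i \<otimes> inv (e j) \<otimes> inv (k \<otimes> inv (e j))) * h (k \<otimes> inv (e j)) =
          f (e i \<otimes> inv k) * h (k \<otimes> inv (e j))" by simp
    qed
    also have "\<dots> = (\<Sum>k\<in>{0..<n}. f (e i \<otimes> inv (e k)) * h (e k \<otimes> inv (e j)))"
      using sum.reindex_bij_betw[OF e, of "\<lambda>k. f (e i \<otimes> inv k) * h (k \<otimes> inv (e j))"]
      by (simp add: n_def)
    finally show ?thesis by (simp add: atLeast0LessThan)
  qed
  have "A (convolution G f h) = A f * A h"
    by (rule eq_matI) (auto simp: A_def entry scalar_prod_def atLeast0LessThan)
  moreover have "group_det G u = det (A u)" for u :: "'a \<Rightarrow> 'c"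
    unfolding group_det_enum[OF e] A_def n_def by simp
  ultimately show ?thesis
    using det_mult[of "A f" n "A h"] by (simp add: A_def)
qed

lemma sum_convolution:
  fixes G (structure)
  assumes "group G" "finite (carrier G)"
  shows "(\<Sum>g\<in>carrier G. convolution G f h g) = (\<Sum>g\<in>carrier G. f g) * (\<Sum>g\<in>carrier G. h g)"
proof -
  interpret group G by fact
  have "(\<Sum>g\<in>carrier G. convolution G f h g) =
      (\<Sum>k\<in>carrier G. (\<Sum>g\<in>carrier G. f (g \<otimes> inv k)) * h k)"
    unfolding convolution_def by (subst sum.swap) (simp add: sum_distrib_right)
  also have "\<dots> = (\<Sum>k\<in>carrier G. (\<Sum>g\<in>carrier G. f g) * h k)"
    by (intro sum.cong refl) (simp add: sum_mult_right[where f = f])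
  finally show ?thesis by (simp add: sum_distrib_left)
qed

section \<open>Passing to a quotient group\<close>

text \<open>Both determinants come from the block matrix \<open>X\<close>: clearing \<open>C\<close>
  by column operations (\<open>R\<close>, determinant 1) leaves a + A C, clearing it by row
  operations (\<open>L\<close>, determinant a^q) leaves a + C A. Keeping the powers of
  \<open>a\<close> avoids division.\<close>

lemma det_scalar_add_mult_swap:
  fixes A C :: "'a::idom mat"
  assumes A: "A \<in> carrier_mat n q" and C: "C \<in> carrier_mat q n"
  shows "a ^ q * det (a \<cdot>\<^sub>m 1\<^sub>m n + A * C) = a ^ n * det (a \<cdot>\<^sub>m 1\<^sub>m q + C * A)"
proof -
  define X where "X = four_block_mat (a \<cdot>\<^sub>m 1\<^sub>m n) (- A) C (1\<^sub>m q)"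
  define L where "L = four_block_mat (1\<^sub>m n) (0\<^sub>m n q) (- C) (a \<cdot>\<^sub>m 1\<^sub>m q)"
  define R where "R = four_block_mat (1\<^sub>m n) (0\<^sub>m n q) (- C) (1\<^sub>m q)"
  have carr: "X \<in> carrier_mat (n + q) (n + q)" "L \<in> carrier_mat (n + q) (n + q)"
      "R \<in> carrier_mat (n + q) (n + q)"
    using A C by (auto simp: X_def L_def R_def)
  have "X * R = four_block_mat (a \<cdot>\<^sub>m 1\<^sub>m n + A * C) (- A) (0\<^sub>m q n) (1\<^sub>m q)"
    unfolding X_def R_def
    by (subst mult_four_block_mat[of _ n n _ q _ q]) (use A C in auto)
  then have "det (X * R) = det (a \<cdot>\<^sub>m 1\<^sub>m n + A * C)"
    using A C by (simp add: det_four_block_mat_lower_left_zero[of _ n _ q])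
  moreover have "det R = 1"
    unfolding R_def using C by (subst det_four_block_mat_upper_right_zero[of _ n _ q]) auto
  ultimately have 1: "det X = det (a \<cdot>\<^sub>m 1\<^sub>m n + A * C)"
    using det_mult[OF carr(1,3)] by simp
  have "L * X = four_block_mat (a \<cdot>\<^sub>m 1\<^sub>m n) (- A) (0\<^sub>m q n) (a \<cdot>\<^sub>m 1\<^sub>m q + C * A)"
    unfolding X_def L_def
    by (subst mult_four_block_mat[of _ n n _ q _ q]) (use A C in \<open>auto simp: mult_smult_distrib[of _ q n] mult_smult_assoc_mat[of _ q q]\<close>)
  then have "det (L * X) = a ^ n * det (a \<cdot>\<^sub>m 1\<^sub>m q + C * A)"
    using A C by (simp add: det_four_block_mat_lower_left_zero[of _ n _ q])
  moreover have "det L = a ^ q"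
    unfolding L_def using C by (subst det_four_block_mat_upper_right_zero[of _ n _ q]) auto
  ultimately show ?thesis
    using det_mult[OF carr(2,1)] 1 by simp
qed

locale finite_group_epi = group_hom +
  assumes finite_G: "finite (carrier G)"
    and surj: "h ` carrier G = carrier H"
begin

abbreviation "r \<equiv> card (kernel G H h)"

abbreviation delta :: "'r::zero \<Rightarrow> 'c \<Rightarrow> 'r" where
  "delta a y \<equiv> if y = \<one>\<^bsub>H\<^esub> then a else 0"

lemma finite_H: "finite (carrier H)"
  using finite_G surj by (metis finite_imageI)

lemma card_fibre:
  assumes "y \<in> carrier H"
  shows "card {x \<in> carrier G. h x = y} = r"
proof -
  have "y \<in> h ` carrier G" using assms by (simp only: surj)
  then obtain g where g: "g \<in> carrier G" "h g = y" by (elim imageE) simp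
  have "bij_betw (\<lambda>k. k \<otimes> g) (kernel G H h) {x \<in> carrier G. h x = y}"
  proof (rule bij_betw_byWitness[where f' = "\<lambda>x. x \<otimes> inv g"])
    show "\<forall>k\<in>kernel G H h. k \<otimes> g \<otimes> inv g = k"
      using g by (simp add: kernel_def G.m_assoc)
    show "\<forall>x\<in>{x \<in> carrier G. h x = y}. x \<otimes> inv g \<otimes> g = x"
      using g by (simp add: G.m_assoc)
    show "(\<lambda>k. k \<otimes> g) ` kernel G H h \<subseteq> {x \<in> carrier G. h x = y}"
      unfolding kernel_def using g assms by (intro image_subsetI CollectI conjI) simp_all
    show "(\<lambda>x. x \<otimes> inv g) ` {x \<in> carrier G. h x = y} \<subseteq> kernel G H h"
      unfolding kernel_def using g assms by (intro image_subsetI CollectI conjI) simp_all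
  qed
  then show ?thesis by (metis bij_betw_same_card)
qed

lemma sum_lift:
  fixes w :: "'c \<Rightarrow> 'r::comm_ring_1"
  shows "(\<Sum>x\<in>carrier G. w (h x)) = of_nat r * (\<Sum>y\<in>carrier H. w y)"
proof -
  have "(\<Sum>x\<in>carrier G. w (h x)) = (\<Sum>y\<in>carrier H. \<Sum>x | x \<in> carrier G \<and> h x = y. w (h x))"
    by (rule sum.group[symmetric]) (use finite_G finite_H in auto)
  also have "\<dots> = (\<Sum>y\<in>carrier H. of_nat r * w y)"
    by (intro sum.cong refl) (simp add: card_fibre)
  finally show ?thesis by (simp add: sum_distrib_left)
qed

text \<open>The group matrix of \<open>w \<circ> h\<close> factors as \<open>A * C\<close>, with
  \<open>C\<close> the incidence matrix of \<open>h\<close>. In the opposite order,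
  \<open>C * A\<close> sums over the fibres of \<open>h\<close>, all of size \<open>r\<close>, and
  gives \<open>r\<close> times the group matrix of \<open>w\<close>.\<close>

lemma group_det_scalar_add_lift:
  fixes w :: "'c \<Rightarrow> 'r::idom"
  shows "a ^ card (carrier H) * group_det G (\<lambda>x. (if x = \<one> then a else 0) + w (h x)) =
    a ^ card (carrier G) * group_det H (\<lambda>y. delta a y + of_nat r * w y)"
proof -
  obtain e where e: "bij_betw e {0..<card (carrier G)} (carrier G)"
    using ex_bij_betw_nat_finite[OF finite_G] by blast
  obtain e' where e': "bij_betw e' {0..<card (carrier H)} (carrier H)"
    using ex_bij_betw_nat_finite[OF finite_H] by blast
  define n where "n = card (carrier G)"
  define q where "q = card (carrier H)"
  have ec: "e i \<in> carrier G" if "i < n" for i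
    using bij_betwE[OF e] that by (simp add: n_def)
  have ec': "e' i \<in> carrier H" if "i < q" for i
    using bij_betwE[OF e'] that by (simp add: q_def)
  have one: "e i \<otimes> inv (e j) = \<one> \<longleftrightarrow> i = j" if "i < n" "j < n" for i j
    using bij_betw_imp_inj_on[OF e] that
    by (auto simp: inj_on_def n_def G.mult_inv_eq_one_iff ec)
  have one': "e' i \<otimes>\<^bsub>H\<^esub> inv\<^bsub>H\<^esub> (e' j) = \<one>\<^bsub>H\<^esub> \<longleftrightarrow> i = j" if "i < q" "j < q" for i j
    using bij_betw_imp_inj_on[OF e'] that
    by (auto simp: inj_on_def q_def H.mult_inv_eq_one_iff ec')
  define A where "A = mat n q (\<lambda>(i, l). w (h (e i) \<otimes>\<^bsub>H\<^esub> inv\<^bsub>H\<^esub> (e' l)))"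
  define C where "C = mat q n (\<lambda>(l, j). if h (e j) = e' l then 1 else (0::'r))"
  have AC: "(\<Sum>l = 0..<q. w (h (e i) \<otimes>\<^bsub>H\<^esub> inv\<^bsub>H\<^esub> (e' l)) * (if h (e j) = e' l then 1 else 0)) =
      w (h (e i \<otimes> inv (e j)))" if "i < n" "j < n" for i j
  proof -
    have "(\<Sum>l = 0..<q. w (h (e i) \<otimes>\<^bsub>H\<^esub> inv\<^bsub>H\<^esub> (e' l)) * (if h (e j) = e' l then 1 else 0)) =
        (\<Sum>y\<in>carrier H. w (h (e i) \<otimes>\<^bsub>H\<^esub> inv\<^bsub>H\<^esub> y) * (if h (e j) = y then 1 else 0))"
      unfolding q_def by (rule sum.reindex_bij_betw[OF e'])
    then show ?thesis
      using that ec finite_H by (simp add: if_distrib[of "(*) _"] cong: if_cong)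
  qed
  have CA: "(\<Sum>i = 0..<n. (if h (e i) = e' l then 1 else 0) * w (h (e i) \<otimes>\<^bsub>H\<^esub> inv\<^bsub>H\<^esub> (e' l'))) =
      of_nat r * w (e' l \<otimes>\<^bsub>H\<^esub> inv\<^bsub>H\<^esub> (e' l'))" if "l < q" "l' < q" for l l'
  proof -
    have "(\<Sum>i = 0..<n. (if h (e i) = e' l then 1 else 0) * w (h (e i) \<otimes>\<^bsub>H\<^esub> inv\<^bsub>H\<^esub> (e' l'))) =
        (\<Sum>x\<in>carrier G. (if h x = e' l then 1 else 0) * w (h x \<otimes>\<^bsub>H\<^esub> inv\<^bsub>H\<^esub> (e' l')))"
      unfolding n_def by (rule sum.reindex_bij_betw[OF e])
    also have "\<dots> = of_nat r * (\<Sum>y\<in>carrier H. (if y = e' l then 1 else 0) * w (y \<otimes>\<^bsub>H\<^esub> inv\<^bsub>H\<^esub> (e' l')))"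
      by (rule sum_lift)
    finally show ?thesis
      using that ec' finite_H by (simp add: if_distrib[of "\<lambda>c. c * _"] cong: if_cong)
  qed
  have "mat n n (\<lambda>(i, j). (if e i \<otimes> inv (e j) = \<one> then a else 0) + w (h (e i \<otimes> inv (e j)))) =
      a \<cdot>\<^sub>m 1\<^sub>m n + A * C"
    by (rule eq_matI)
      (auto simp: A_def C_def scalar_prod_def AC one simp del: hom_mult)
  moreover have "mat q q (\<lambda>(i, j). delta a (e' i \<otimes>\<^bsub>H\<^esub> inv\<^bsub>H\<^esub> (e' j)) +
      of_nat r * w (e' i \<otimes>\<^bsub>H\<^esub> inv\<^bsub>H\<^esub> (e' j))) = a \<cdot>\<^sub>m 1\<^sub>m q + C * A"
    by (rule eq_matI)
      (auto simp: A_def C_def scalar_prod_def CA one')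
  ultimately show ?thesis
    unfolding group_det_enum[OF e] group_det_enum[OF e'] n_def[symmetric] q_def[symmetric]
    using det_scalar_add_mult_swap[of A n q C a] by (simp add: A_def C_def)
qed

text \<open>Since \<open>w (h k)\<close> depends only on the image of k, the convolution adds up
  \<open>u\<close> over each fibre; only the fibre over the identity contributes, with total
  \<open>a\<close>.\<close>

lemma convolution_lift:
  assumes u: "\<And>y. y \<in> carrier H \<Longrightarrow> (\<Sum>x | x \<in> carrier G \<and> h x = y. u x) = delta a y"
    and g: "g \<in> carrier G"
  shows "convolution G u (\<lambda>x. w (h x)) g = a * w (h g)"
proof -
  have "convolution G u (\<lambda>x. w (h x)) g = (\<Sum>m\<in>carrier G. u m * w (inv\<^bsub>H\<^esub> (h m) \<otimes>\<^bsub>H\<^esub> h g))"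
    unfolding convolution_def
  \<comment> \<open>Substitution m = g k^-1, that is k = m^-1 g.\<close>
  proof (rule sum.reindex_bij_witness[of _ "\<lambda>m. inv m \<otimes> g" "\<lambda>k. g \<otimes> inv k"])
    fix k assume k: "k \<in> carrier G"
    have "inv (g \<otimes> inv k) = k \<otimes> inv g"
      using k g by (simp add: G.inv_mult_group)
    then show *: "inv (g \<otimes> inv k) \<otimes> g = k"
      using k g by (simp add: G.m_assoc)
    have "inv\<^bsub>H\<^esub> (h (g \<otimes> inv k)) \<otimes>\<^bsub>H\<^esub> h g = h (inv (g \<otimes> inv k) \<otimes> g)"
      using k g by (simp del: G.inv_mult_group)
    then show "u (g \<otimes> inv k) * w (inv\<^bsub>H\<^esub> (h (g \<otimes> inv k)) \<otimes>\<^bsub>H\<^esub> h g) = u (g \<otimes> inv k) * w (h k)"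
      by (simp only: *)
  next
    fix m assume m: "m \<in> carrier G"
    have "inv (inv m \<otimes> g) = inv g \<otimes> m"
      using m g by (simp add: G.inv_mult_group)
    then show "g \<otimes> inv (inv m \<otimes> g) = m"
      using m g by (simp add: G.r_cancel_inv)
  qed (use g in simp_all)
  also have "\<dots> = (\<Sum>y\<in>carrier H. \<Sum>m | m \<in> carrier G \<and> h m = y. u m * w (inv\<^bsub>H\<^esub> (h m) \<otimes>\<^bsub>H\<^esub> h g))"
    by (rule sum.group[symmetric]) (use finite_G finite_H in auto)
  also have "\<dots> = (\<Sum>y\<in>carrier H. delta a y * w (inv\<^bsub>H\<^esub> y \<otimes>\<^bsub>H\<^esub> h g))"
    by (intro sum.cong refl) (simp add: u flip: sum_distrib_right)
  also have "\<dots> = a * w (h g)"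
    using finite_H g by (simp add: if_distrib[of "\<lambda>c. c * _"] cong: if_cong)
  finally show ?thesis .
qed

lemma group_det_add_lift:
  fixes u :: "'a \<Rightarrow> 'r::idom"
  assumes u: "\<And>y. y \<in> carrier H \<Longrightarrow> (\<Sum>x | x \<in> carrier G \<and> h x = y. u x) = delta a y"
    and a: "a \<noteq> 0"
  shows "a ^ card (carrier H) * group_det G (\<lambda>x. u x + w (h x)) =
    group_det G u * group_det H (\<lambda>y. delta a y + of_nat r * w y)"
proof -
  \<comment> \<open>In the group ring, \<open>u * (a + w \<circ> h) = a * (u + w \<circ> h)\<close>.\<close>
  let ?d = "\<lambda>x. (if x = \<one> then a else 0) + w (h x)"
  have "convolution G u ?d g = (convolution G (\<lambda>x. if x = \<one> then a else 0) (\<lambda>x. u x + w (h x))) g"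
    if g: "g \<in> carrier G" for g
  proof -
    have "convolution G u ?d g = (\<Sum>k\<in>carrier G. u (g \<otimes> inv k) * (if k = \<one> then a else 0)) +
        convolution G u (\<lambda>x. w (h x)) g"
      by (simp add: convolution_def distrib_left sum.distrib)
    also have "\<dots> = a * (u g + w (h g))"
      using g finite_G
      by (simp add: convolution_lift[OF u] if_distrib[of "(*) _"] distrib_left mult.commute[of _ a] cong: if_cong)
    also have "\<dots> = (convolution G (\<lambda>x. if x = \<one> then a else 0) (\<lambda>x. u x + w (h x))) g"
      using g finite_G by (simp add: convolution_def G.mult_inv_eq_one_iff
          if_distrib[of "\<lambda>c. c * _"] cong: if_cong)
    finally show ?thesis .
  qed
  then have "group_det G (convolution G u ?d) =
      group_det G (convolution G (\<lambda>x. if x = \<one> then a else 0) (\<lambda>x. u x + w (h x)))"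
    by (rule group_det_cong[OF G.is_group finite_G])
  then have *: "group_det G u * group_det G ?d =
      a ^ card (carrier G) * group_det G (\<lambda>x. u x + w (h x))"
    by (simp add: group_det_convolution[OF G.is_group finite_G]
        group_det_scalar[OF G.is_group finite_G])
  \<comment> \<open>The extra factor a^|G| makes room for \<open>*\<close> and for the scalar case;
    it cancels at the end because \<open>a\<close> is nonzero.\<close>
  have "a ^ card (carrier G) * (a ^ card (carrier H) * group_det G (\<lambda>x. u x + w (h x))) =
      a ^ card (carrier H) * (a ^ card (carrier G) * group_det G (\<lambda>x. u x + w (h x)))"
    by (simp add: mult_ac)
  also have "\<dots> = group_det G u * (a ^ card (carrier H) * group_det G ?d)"
    by (simp add: mult_ac flip: *)
  also have "\<dots> = a ^ card (carrier G) * (group_det G u * group_det H (\<lambda>y. delta a y + of_nat r * w y))"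
    by (subst group_det_scalar_add_lift) (simp add: mult_ac)
  finally show ?thesis using a by simp
qed

text \<open>Adding the indicator function of the kernel to \<open>u\<close> replaces \<open>a\<close> by \<open>a + r\<close>, which is
  coprime to \<open>a\<close>; so \<open>a ^ q\<close> must divide the determinant of \<open>u\<close> itself.\<close>

lemma power_dvd_group_det:
  fixes u :: "'a \<Rightarrow> int"
  assumes u: "\<And>y. y \<in> carrier H \<Longrightarrow> (\<Sum>x | x \<in> carrier G \<and> h x = y. u x) = delta a y"
    and a: "coprime a (int r)" "a \<noteq> 0"
  shows "a ^ card (carrier H) dvd group_det G u"
proof -
  have "a ^ card (carrier H) * group_det G (\<lambda>x. u x + delta 1 (h x)) =
      group_det G u * group_det H (\<lambda>y. delta a y + int r * delta 1 y)"
    by (rule group_det_add_lift[OF u a(2)])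
  also have "(\<lambda>y. delta a y + int r * delta 1 y) = delta (a + int r)"
    by auto
  finally have "a ^ card (carrier H) dvd group_det G u * (a + int r) ^ card (carrier H)"
    using group_det_scalar[OF H.is_group finite_H, of "a + int r"] by (metis dvd_triv_left)
  moreover have "coprime (a ^ card (carrier H)) ((a + int r) ^ card (carrier H))"
    using a(1) by (intro coprime_power_left_iff[THEN iffD2] coprime_power_right_iff[THEN iffD2] disjI1)
      (simp add: coprime_iff_gcd_eq_1)
  ultimately show ?thesis by (simp add: coprime_dvd_mult_left_iff)
qed

end

section \<open>Images of monoid algebras in group rings\<close>

text \<open>In the binomial expansion of \<open>(x j + s) ^ p\<close> every term but the two extreme
  ones carries a factor p, so induction over \<open>S\<close> applies. A general commutative ring is
  allowed because both the integers and the monoid algebra are needed.\<close>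

lemma sum_power_prime:
  fixes x :: "'i \<Rightarrow> 'r::comm_ring_1"
  assumes "prime p" "finite S"
  shows "\<exists>w. (\<Sum>i\<in>S. x i) ^ p = (\<Sum>i\<in>S. x i ^ p) + of_nat p * w"
  using \<open>finite S\<close>
proof induction
  case empty
  then show ?case using prime_gt_0_nat[OF \<open>prime p\<close>] by (auto intro: exI[of _ 0] simp: zero_power)
next
  case (insert j S)
  then obtain w where w: "(\<Sum>i\<in>S. x i) ^ p = (\<Sum>i\<in>S. x i ^ p) + of_nat p * w" by blast
  define s where "s = (\<Sum>i\<in>S. x i)"
  have p: "p = Suc (p - 1)" using prime_gt_0_nat[OF \<open>prime p\<close>] by simp
  have "of_nat p dvd (\<Sum>k\<in>{1..<p}. of_nat (p choose k) * x j ^ k * s ^ (p - k))"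
  proof (intro dvd_sum dvd_mult2)
    fix k assume "k \<in> {1..<p}"
    then have "p dvd p choose k" by (intro dvd_choose_prime \<open>prime p\<close>) auto
    then obtain c where "p choose k = p * c" by (elim dvdE)
    then show "of_nat p dvd (of_nat (p choose k) :: 'r)" by simp
  qed
  then obtain v where v: "(\<Sum>k\<in>{1..<p}. of_nat (p choose k) * x j ^ k * s ^ (p - k)) = of_nat p * v"
    by (elim dvdE)
  have "(x j + s) ^ p = (\<Sum>k\<le>p. of_nat (p choose k) * x j ^ k * s ^ (p - k))"
    by (rule binomial_ring)
  also have "{..p} = insert 0 (insert p {1..<p})"
    using p by auto
  also have "(\<Sum>k\<in>\<dots>. of_nat (p choose k) * x j ^ k * s ^ (p - k)) = s ^ p + x j ^ p + of_nat p * v"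
    using p v by (subst sum.insert; simp)+
  finally have "(x j + s) ^ p = x j ^ p + (\<Sum>i\<in>S. x i ^ p) + of_nat p * (w + v)"
    by (simp add: w s_def algebra_simps)
  then show ?case using insert.hyps by (auto simp: s_def)
qed

text \<open>Fermat's little theorem: the preceding lemma for a sum of n ones, where n is the residue
  of \<open>c\<close>.\<close>

lemma prime_dvd_power_diff:
  fixes c :: int
  assumes "prime p"
  shows "int p dvd c ^ p - c"
proof -
  define n where "n = nat (c mod int p)"
  have p: "0 < p" using prime_gt_0_nat[OF assms] .
  have n: "int n = c mod int p" using p by (simp add: n_def)
  obtain w :: int where "(\<Sum>i<n. 1) ^ p = (\<Sum>i<n. 1 ^ p) + of_nat p * w"
    using sum_power_prime[OF assms, of "{..<n}" "\<lambda>_. 1"] by auto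
  then have "[int n ^ p = int n] (mod int p)"
    by (simp add: cong_iff_dvd_diff)
  moreover have "[c = int n] (mod int p)" by (simp add: n cong_def)
  ultimately have "[c ^ p = c] (mod int p)"
    by (meson cong_pow cong_sym cong_trans)
  then show ?thesis by (simp add: cong_iff_dvd_diff)
qed

text \<open>Group ring elements are functions on the carrier, which do not form a ring type.
  The commutative ring \<open>'k \<Rightarrow>\<^sub>0 int\<close> replaces them where ring identities or the
  binomial theorem are needed.\<close>

definition push :: "('k \<Rightarrow> 'g) \<Rightarrow> ('k \<Rightarrow>\<^sub>0 int) \<Rightarrow> 'g \<Rightarrow> int" where
  "push \<phi> F g = (\<Sum>k\<in>Poly_Mapping.keys F. if \<phi> k = g then Poly_Mapping.lookup F k else 0)"

lemma push_superset:
  assumes "finite S" "Poly_Mapping.keys F \<subseteq> S"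
  shows "push \<phi> F g = (\<Sum>k\<in>S. if \<phi> k = g then Poly_Mapping.lookup F k else 0)"
  unfolding push_def using assms by (intro sum.mono_neutral_left) (auto simp: in_keys_iff)

lemma push_zero [simp]: "push \<phi> 0 g = 0"
  by (simp add: push_def)

lemma push_add: "push \<phi> (F + F') g = push \<phi> F g + push \<phi> F' g"
proof -
  let ?S = "Poly_Mapping.keys F \<union> Poly_Mapping.keys F'"
  have "push \<phi> (F + F') g = (\<Sum>k\<in>?S. if \<phi> k = g then Poly_Mapping.lookup (F + F') k else 0)"
    by (rule push_superset) (auto simp: keys_add)
  moreover have "push \<phi> F g = (\<Sum>k\<in>?S. if \<phi> k = g then Poly_Mapping.lookup F k else 0)"
    "push \<phi> F' g = (\<Sum>k\<in>?S. if \<phi> k = g then Poly_Mapping.lookup F' k else 0)"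
    by (rule push_superset; simp)+
  ultimately show ?thesis
    by (simp flip: sum.distrib) (intro sum.cong; simp add: lookup_add)
qed

lemma push_single: "push \<phi> (Poly_Mapping.single k c) g = (if \<phi> k = g then c else 0)"
  by (simp add: push_def)

lemma push_sum: "push \<phi> (\<Sum>i\<in>S. F i) g = (\<Sum>i\<in>S. push \<phi> (F i) g)"
  by (induction S rule: infinite_finite_induct) (simp_all add: push_add)

lemma push_of_nat_mult: "push \<phi> (of_nat n * F) g = int n * push \<phi> F g"
  by (induction n) (simp_all add: push_add algebra_simps)

lemma poly_mapping_expand:
  "F = (\<Sum>k\<in>Poly_Mapping.keys F. Poly_Mapping.single k (Poly_Mapping.lookup F k))"
  by (rule poly_mapping_eqI) (simp add: lookup_sum lookup_single when_def in_keys_iff)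

text \<open>Here \<open>push \<phi>\<close> is a ring homomorphism from the monoid algebra to the
  group ring. Only the source is commutative, so \<open>G\<close> may be non-abelian, with the image
  of \<open>\<phi>\<close> a commuting set.\<close>

locale monoid_algebra_hom = group +
  fixes \<phi> :: "'k::comm_monoid_add \<Rightarrow> 'a"
  assumes finite_G: "finite (carrier G)"
    and closed [simp]: "\<phi> k \<in> carrier G"
    and zero [simp]: "\<phi> 0 = \<one>"
    and add: "\<phi> (k + l) = \<phi> k \<otimes> \<phi> l"
begin

lemma sum_push: "(\<Sum>g\<in>carrier G. push \<phi> F g) = (\<Sum>k\<in>Poly_Mapping.keys F. Poly_Mapping.lookup F k)"
  unfolding push_def using finite_G by (subst sum.swap) simp

lemma push_one: "push \<phi> 1 g = (if g = \<one> then 1 else 0)"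
  using push_single[of \<phi> 0 1 g] by auto

lemma push_mult:
  assumes g: "g \<in> carrier G"
  shows "push \<phi> (F * F') g = convolution G (push \<phi> F) (push \<phi> F') g"
proof -
  let ?K = "Poly_Mapping.keys" and ?l = "Poly_Mapping.lookup"
  have "F * F' = (\<Sum>k\<in>?K F. \<Sum>l\<in>?K F'. Poly_Mapping.single (k + l) (?l F k * ?l F' l))"
    by (subst (1) poly_mapping_expand[of F], subst (1) poly_mapping_expand[of F'])
      (simp add: sum_product mult_single)
  then have "push \<phi> (F * F') g = (\<Sum>k\<in>?K F. \<Sum>l\<in>?K F'. if \<phi> k \<otimes> \<phi> l = g then ?l F k * ?l F' l else 0)"
    by (simp add: push_sum push_single add)
  \<comment> \<open>For fixed k and l only x = \<open>\<phi> l\<close> contributes; the inserted sum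
    over x becomes the convolution sum after swapping.\<close>
  also have "\<dots> = (\<Sum>k\<in>?K F. \<Sum>l\<in>?K F'. \<Sum>x\<in>carrier G.
      (if \<phi> k = g \<otimes> inv x then ?l F k else 0) * (if \<phi> l = x then ?l F' l else 0))"
  proof (intro sum.cong refl)
    fix k l
    have "(\<Sum>x\<in>carrier G. (if \<phi> k = g \<otimes> inv x then ?l F k else 0) * (if \<phi> l = x then ?l F' l else 0)) =
        (\<Sum>x\<in>carrier G. if \<phi> l = x then (if \<phi> k = g \<otimes> inv x then ?l F k else 0) * ?l F' l else 0)"
      by (intro sum.cong) auto
    also have "\<dots> = (if \<phi> k = g \<otimes> inv (\<phi> l) then ?l F k else 0) * ?l F' l"
      using finite_G by simp
    also have "\<phi> k = g \<otimes> inv (\<phi> l) \<longleftrightarrow> \<phi> k \<otimes> \<phi> l = g"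
      using g by (metis closed inv_solve_right)
    finally show "(if \<phi> k \<otimes> \<phi> l = g then ?l F k * ?l F' l else 0) =
        (\<Sum>x\<in>carrier G. (if \<phi> k = g \<otimes> inv x then ?l F k else 0) * (if \<phi> l = x then ?l F' l else 0))"
      by simp
  qed
  also have "\<dots> = (\<Sum>x\<in>carrier G. \<Sum>k\<in>?K F. \<Sum>l\<in>?K F'.
      (if \<phi> k = g \<otimes> inv x then ?l F k else 0) * (if \<phi> l = x then ?l F' l else 0))"
    by (simp only: sum.swap[where A = "carrier G"])
  also have "\<dots> = convolution G (push \<phi> F) (push \<phi> F') g"
    by (simp add: convolution_def push_def sum_product)
  finally show ?thesis .
qed

lemma group_det_push_mult:
  "group_det G (push \<phi> (F * F')) = group_det G (push \<phi> F) * group_det G (push \<phi> F')"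
  by (subst group_det_convolution[OF is_group finite_G, symmetric])
    (intro group_det_cong is_group finite_G push_mult)

lemma group_det_push_power: "group_det G (push \<phi> (F ^ n)) = group_det G (push \<phi> F) ^ n"
proof (induction n)
  case 0
  have "group_det G (push \<phi> 1) = 1"
    using group_det_scalar[OF is_group finite_G, of "1::int"]
    by (subst group_det_cong[OF is_group finite_G push_one]) simp_all
  then show ?case by simp
qed (simp add: group_det_push_mult)

lemma sum_push_power: "(\<Sum>g\<in>carrier G. push \<phi> (F ^ n) g) = (\<Sum>g\<in>carrier G. push \<phi> F g) ^ n"
proof (induction n)
  case 0
  show ?case using finite_G by (simp add: push_one)
next
  case (Suc n)
  have "(\<Sum>g\<in>carrier G. push \<phi> (F ^ Suc n) g) =
      (\<Sum>g\<in>carrier G. convolution G (push \<phi> F) (push \<phi> (F ^ n)) g)"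
    by (intro sum.cong refl) (simp add: push_mult)
  then show ?case by (simp add: sum_convolution[OF is_group finite_G] Suc)
qed

lemma push_single_power:
  "push \<phi> (Poly_Mapping.single k c ^ n) g = (if \<phi> k [^] n = g then c ^ n else 0)"
proof -
  have "\<exists>l. Poly_Mapping.single k c ^ n = Poly_Mapping.single l (c ^ n) \<and> \<phi> l = \<phi> k [^] n"
  proof (induction n)
    case (Suc n)
    then obtain l where "Poly_Mapping.single k c ^ n = Poly_Mapping.single l (c ^ n)" "\<phi> l = \<phi> k [^] n"
      by blast
    then have "Poly_Mapping.single k c ^ Suc n = Poly_Mapping.single (k + l) (c ^ Suc n)"
      "\<phi> (k + l) = \<phi> k [^] Suc n"
      using nat_pow_Suc2[of "\<phi> k" n] by (simp_all add: mult_single add)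
    then show ?case by blast
  qed (auto intro!: exI[of _ 0])
  then show ?thesis by (auto simp: push_single)
qed

text \<open>Modulo p, \<open>F ^ p\<close> is the sum of the p-th powers of its terms. The exponent
  hypothesis sends each monomial power to the identity, and Fermat's theorem reduces the
  coefficients.\<close>

lemma push_power_prime:
  assumes "prime p" and exponent: "\<And>k. \<phi> k [^] p = \<one>"
  shows "\<exists>w. \<forall>g. push \<phi> (F ^ p) g =
    (if g = \<one> then \<Sum>k\<in>Poly_Mapping.keys F. Poly_Mapping.lookup F k else 0) + int p * w g"
proof -
  let ?K = "Poly_Mapping.keys F" and ?l = "Poly_Mapping.lookup F"
  obtain W where "F ^ p = (\<Sum>k\<in>?K. Poly_Mapping.single k (?l k) ^ p) + of_nat p * W"
    using sum_power_prime[OF assms(1), of ?K "\<lambda>k. Poly_Mapping.single k (?l k)"]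
    by (auto simp flip: poly_mapping_expand)
  then have *: "push \<phi> (F ^ p) g = (if g = \<one> then \<Sum>k\<in>?K. ?l k ^ p else 0) + int p * push \<phi> W g" for g
    by (simp add: push_add push_sum push_single_power push_of_nat_mult exponent)
  have "int p dvd (\<Sum>k\<in>?K. ?l k ^ p - ?l k)"
    by (intro dvd_sum prime_dvd_power_diff assms(1))
  then obtain c where "(\<Sum>k\<in>?K. ?l k ^ p) - (\<Sum>k\<in>?K. ?l k) = int p * c"
    by (auto simp: sum_subtractf)
  \<comment> \<open>The multiple of p has two sources: \<open>c\<close> from Fermat's theorem,
    located at the identity, and \<open>W\<close> from the binomial terms.\<close>
  then show ?thesis
    by (intro exI[of _ "\<lambda>g. (if g = \<one> then c else 0) + push \<phi> W g"]) (auto simp: * algebra_simps)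
qed

lemma exists_push:
  assumes "carrier G \<subseteq> range \<phi>"
  shows "\<exists>F. \<forall>g\<in>carrier G. push \<phi> F g = f g"
proof (intro exI ballI)
  fix g assume g: "g \<in> carrier G"
  have "\<phi> (inv_into UNIV \<phi> x) = x" if "x \<in> carrier G" for x
    using assms that by (auto intro: f_inv_into_f)
  then have "push \<phi> (\<Sum>x\<in>carrier G. Poly_Mapping.single (inv_into UNIV \<phi> x) (f x)) g =
      (\<Sum>x\<in>carrier G. if x = g then f x else 0)"
    unfolding push_sum push_single by (intro sum.cong) auto
  then show "push \<phi> (\<Sum>x\<in>carrier G. Poly_Mapping.single (inv_into UNIV \<phi> x) (f x)) g = f g"
    using g finite_G by simp
qed

text \<open>The witness is the p-th power of a preimage of \<open>f\<close>. Coefficient sum and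
  determinant are multiplicative, and being scalar modulo p makes the element fit the lifting
  formula for a kernel of order p.\<close>

lemma exists_scalar_mod_prime:
  assumes "prime p" "\<And>k. \<phi> k [^] p = \<one>" "carrier G \<subseteq> range \<phi>"
    and f: "(\<Sum>g\<in>carrier G. f g) = \<alpha>"
  shows "\<exists>w. (\<Sum>g\<in>carrier G. (if g = \<one> then \<alpha> else 0) + int p * w g) = \<alpha> ^ p \<and>
    group_det G (\<lambda>g. (if g = \<one> then \<alpha> else 0) + int p * w g) = group_det G f ^ p"
proof -
  obtain F where F: "\<And>g. g \<in> carrier G \<Longrightarrow> push \<phi> F g = f g"
    using exists_push[OF assms(3)] by metis
  have \<alpha>: "(\<Sum>g\<in>carrier G. push \<phi> F g) = \<alpha>" by (simp add: F f)
  then obtain w where w: "push \<phi> (F ^ p) = (\<lambda>g. (if g = \<one> then \<alpha> else 0) + int p * w g)"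
    using push_power_prime[OF assms(1,2), of F] unfolding sum_push by (auto simp: fun_eq_iff)
  have "group_det G (push \<phi> F) = group_det G f"
    by (rule group_det_cong[OF is_group finite_G F])
  then show ?thesis
    using sum_push_power[of F p] group_det_push_power[of F p] unfolding \<alpha> w by auto
qed

end

section \<open>Cyclic kernels\<close>

lemma sum_lessThan_mult:
  fixes f :: "nat \<Rightarrow> 'a::comm_monoid_add"
  shows "(\<Sum>i<m * n. f i) = (\<Sum>j<m. \<Sum>i<n. f (j * n + i))"
proof -
  have "sum f {j * n..<j * n + n} = (\<Sum>i<n. f (j * n + i))" for j
    using sum.shift_bounds_nat_ivl[of f 0 "j * n" n] by (simp add: atLeast0LessThan add.commute)
  then show ?thesis by (simp flip: sum.nat_group)
qed

text \<open>The kernel has \<open>n\<close> elements and is listed by \<open>n\<close> powers, so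
  these are distinct and \<open>z\<close> has order exactly \<open>n\<close>.\<close>

locale cyclic_kernel = finite_group_epi +
  fixes z :: 'a and n :: nat
  assumes z [simp]: "z \<in> carrier G"
    and z_pow: "z [^] n = \<one>"
    and card_kernel: "card (kernel G H h) = n"
    and kernel_eq: "kernel G H h = (\<lambda>i::nat. z [^] i) ` {..<n}"
begin

sublocale powers: monoid_algebra_hom G "\<lambda>i::nat. z [^] i"
  by unfold_locales (simp_all add: finite_G G.nat_pow_mult)

lemma z_pow_mult: "z [^] (k * n) = \<one>"
  using G.nat_pow_pow[of z n k] by (simp add: z_pow mult.commute)

lemma h_z_pow [simp]: "h (z [^] (i::nat)) = \<one>\<^bsub>H\<^esub>"
proof -
  have "\<one> \<in> kernel G H h" by (simp add: kernel_def)
  then have "n > 0" unfolding kernel_eq by auto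
  have "z [^] i = z [^] (i div n * n) \<otimes> z [^] (i mod n)"
    by (simp add: G.nat_pow_mult)
  also have "\<dots> = z [^] (i mod n)"
    by (simp add: z_pow_mult)
  also have "\<dots> \<in> kernel G H h"
    unfolding kernel_eq using \<open>n > 0\<close> by simp
  finally show ?thesis by (simp add: kernel_def)
qed

lemma inj_z_pow: "inj_on (\<lambda>i::nat. z [^] i) {..<n}"
  by (rule eq_card_imp_inj_on) (simp_all add: card_kernel flip: kernel_eq)

text \<open>\<open>nat \<Rightarrow>\<^sub>0 int\<close> is the polynomial ring Z[X], and
  \<open>push_z\<close> evaluates a polynomial at X = z.\<close>

abbreviation "push_z \<equiv> push (\<lambda>i::nat. z [^] i)"

abbreviation "geometric a \<equiv> \<Sum>i<a. Poly_Mapping.single (i::nat) (1::int)"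

text \<open>Every power of \<open>z\<close> lies in the kernel, so a polynomial in \<open>z\<close>
  maps to a scalar of the group ring of \<open>H\<close>.\<close>

lemma fibre_sum_push:
  assumes y: "y \<in> carrier H"
  shows "(\<Sum>x | x \<in> carrier G \<and> h x = y. push_z F x) = delta (\<Sum>x\<in>carrier G. push_z F x) y"
proof -
  let ?K = "Poly_Mapping.keys F" and ?l = "Poly_Mapping.lookup F"
  have "(\<Sum>x | x \<in> carrier G \<and> h x = y. push_z F x) =
      (\<Sum>k\<in>?K. \<Sum>x | x \<in> carrier G \<and> h x = y. if z [^] k = x then ?l k else 0)"
    unfolding push_def by (rule sum.swap)
  also have "\<dots> = (\<Sum>k\<in>?K. delta (?l k) y)"
    using finite_G by (intro sum.cong refl) auto
  finally show ?thesis by (simp add: powers.sum_push)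
qed

lemma sum_push_geometric: "(\<Sum>x\<in>carrier G. push_z (geometric a) x) = int a"
  unfolding push_sum push_single using finite_G by (subst sum.swap) simp

text \<open>Each exponent below b a is uniquely j a + i with i < a; the second factor is (X^(ba) -
  1)/(X^a - 1).\<close>

lemma geometric_mult:
  "geometric (b * a) = geometric a * (\<Sum>j<b. Poly_Mapping.single (j * a) 1)"
  unfolding sum_lessThan_mult
  by (simp add: sum_product mult_single add.commute, subst sum.swap) simp

text \<open>The first k n powers of \<open>z\<close> run k times through the kernel, and the
  remaining one, z^(k n), is the identity.\<close>

lemma push_geometric:
  assumes g: "g \<in> carrier G"
  shows "push_z (geometric (k * n + 1)) g = (if g = \<one> then 1 else 0) + delta (int k) (h g)"
proof -
  have shift: "z [^] (j * n + i) = z [^] i" for i j :: nat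
    using G.nat_pow_mult[of z "j * n" i] by (simp add: z_pow_mult)
  have "(\<Sum>i<n. if z [^] i = g then 1 else 0) = (\<Sum>x\<in>kernel G H h. if x = g then 1 else (0::int))"
    by (simp add: kernel_eq sum.reindex[OF inj_z_pow])
  also have "\<dots> = delta 1 (h g)"
    using g finite_G by (simp add: kernel_def)
  finally have *: "(\<Sum>i<n. if z [^] i = g then 1 else (0::int)) = delta 1 (h g)" .
  have "push_z (geometric (k * n + 1)) g =
      (\<Sum>i<k * n. if z [^] i = g then 1 else 0) + (if g = \<one> then 1 else 0)"
    by (auto simp: push_sum push_add push_single z_pow_mult)
  then show ?thesis
    unfolding sum_lessThan_mult shift * by simp
qed

text \<open>With b inverse to \<open>a\<close> modulo \<open>n\<close>, a complementary factor
  \<open>V\<close> turns the element into 1 plus k times the kernel sum, of determinant (ab)^q. The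
  two factors have determinants divisible by a^q and b^q, which leaves only signs.\<close>

lemma group_det_geometric:
  assumes "coprime a n" "n > 1"
  shows "\<bar>group_det G (push_z (geometric a))\<bar> = int a ^ card (carrier H)"
proof -
  let ?q = "card (carrier H)"
  obtain b where "[a * b = 1] (mod n)"
    using cong_solve_coprime_nat[OF assms(1)] by auto
  then have "a * b mod n = 1" using assms(2) by (simp add: cong_def)
  then obtain k where k: "b * a = k * n + 1"
    by (metis div_mult_mod_eq mult.commute)
  then have nz: "a \<noteq> 0" "b \<noteq> 0" by (metis Suc_eq_plus1 mult_0 mult_0_right nat.distinct(1))+
  have "coprime (b * a) n" unfolding k by (rule coprimeI) (metis dvd_add_right_iff dvd_mult)
  then have cop: "coprime (int a) (int n)" "coprime (int b) (int n)"
    by simp_all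
  define V where "V = (\<Sum>j<b. Poly_Mapping.single (j * a) (1::int))"
  have "(\<Sum>x\<in>carrier G. push_z V x) = int b"
    unfolding V_def push_sum push_single using finite_G by (subst sum.swap) simp
  then have V: "int b ^ ?q dvd group_det G (push_z V)"
    using fibre_sum_push[of _ V] nz cop by (intro power_dvd_group_det) (simp_all add: card_kernel)
  have U: "int a ^ ?q dvd group_det G (push_z (geometric a))"
    using fibre_sum_push[of _ "geometric a"] nz cop
    by (intro power_dvd_group_det) (simp_all add: sum_push_geometric card_kernel)
  have fib1: "(\<Sum>x | x \<in> carrier G \<and> h x = y. if x = \<one> then 1 else 0) = delta (1::int) y"
    if "y \<in> carrier H" for y
    using finite_G by (simp add: eq_commute)
  have "group_det G (push_z (geometric a)) * group_det G (push_z V) =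
      group_det G (push_z (geometric (b * a)))"
    unfolding geometric_mult V_def by (rule powers.group_det_push_mult[symmetric])
  also have "\<dots> = group_det G (\<lambda>g. (if g = \<one> then 1 else 0) + delta (int k) (h g))"
    unfolding k by (intro group_det_cong G.is_group finite_G push_geometric)
  \<comment> \<open>The lifting formula with \<open>u\<close> the identity of the group ring; on
    \<open>H\<close> the result is the scalar 1 + n k = b a.\<close>
  also have "\<dots> = group_det H (\<lambda>y. delta 1 y + int n * delta (int k) y)"
    using group_det_add_lift[OF fib1, of "delta (int k)"]
    by (simp add: group_det_scalar[OF G.is_group finite_G] card_kernel)
  also have "(\<lambda>y. delta 1 y + int n * delta (int k) y) = delta (int (b * a))"
    unfolding k by auto
  also have "group_det H \<dots> = int a ^ ?q * int b ^ ?q"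
    by (simp add: group_det_scalar[OF H.is_group finite_H] power_mult_distrib mult.commute)
  finally have eq: "group_det G (push_z (geometric a)) * group_det G (push_z V) = int a ^ ?q * int b ^ ?q" .
  obtain c d where c: "group_det G (push_z (geometric a)) = int a ^ ?q * c"
    and d: "group_det G (push_z V) = int b ^ ?q * d"
    using U V by (elim dvdE)
  have "(int a ^ ?q * int b ^ ?q) * (c * d) = (int a ^ ?q * int b ^ ?q) * 1"
    using eq unfolding c d by (simp add: mult_ac)
  then have "c * d = 1" using nz by simp
  then have "\<bar>c\<bar> = 1" by (auto simp: zmult_eq_1_iff)
  then show ?thesis unfolding c by (simp add: abs_mult)
qed

text \<open>One rung of the tower. If \<open>f ^ n\<close> is \<alpha> + n w in the group ring of
  \<open>H\<close>, the witness is the geometric element of length \<alpha> in \<open>z\<close> plus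
  the lift of \<open>w\<close>.\<close>

lemma exists_group_det_power:
  fixes \<phi> :: "'k::comm_monoid_add \<Rightarrow> 'c"
  assumes "prime n" "monoid_algebra_hom H \<phi>" "carrier H \<subseteq> range \<phi>"
    and exponent: "\<And>k. \<phi> k [^]\<^bsub>H\<^esub> n = \<one>\<^bsub>H\<^esub>"
    and f: "(\<Sum>y\<in>carrier H. f y) = int \<alpha>" "\<bar>group_det H f\<bar> = int \<alpha>" "\<not> n dvd \<alpha>"
  shows "\<exists>f'. (\<Sum>x\<in>carrier G. f' x) = int (\<alpha> ^ n) \<and> \<bar>group_det G f'\<bar> = int (\<alpha> ^ n)"
proof -
  interpret \<phi>: monoid_algebra_hom H \<phi> by fact
  have \<alpha>: "coprime \<alpha> n" "\<alpha> \<noteq> 0"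
    using f(3) prime_imp_coprime[OF assms(1)] by (auto simp: coprime_commute intro!: Nat.gr0I)
  obtain w where w: "(\<Sum>y\<in>carrier H. delta (int \<alpha>) y + int n * w y) = int \<alpha> ^ n"
    "group_det H (\<lambda>y. delta (int \<alpha>) y + int n * w y) = group_det H f ^ n"
    using \<phi>.exists_scalar_mod_prime[OF assms(1) exponent assms(3) f(1)] by blast
  let ?u = "push_z (geometric \<alpha>)"
  have "(\<Sum>x\<in>carrier G. ?u x + w (h x)) = int (\<alpha> ^ n)"
    using w(1) finite_H by (simp add: sum.distrib sum_push_geometric sum_lift card_kernel flip: sum_distrib_left)
  moreover have "\<bar>group_det G (\<lambda>x. ?u x + w (h x))\<bar> = int (\<alpha> ^ n)"
  proof -
    have "(\<Sum>x | x \<in> carrier G \<and> h x = y. ?u x) = delta (int \<alpha>) y" if "y \<in> carrier H" for y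
      using that by (simp add: fibre_sum_push sum_push_geometric)
    then have "int \<alpha> ^ card (carrier H) * group_det G (\<lambda>x. ?u x + w (h x)) =
        group_det G ?u * group_det H (\<lambda>y. delta (int \<alpha>) y + int n * w y)"
      using group_det_add_lift[of ?u "int \<alpha>" w] \<alpha>(2) by (simp add: card_kernel)
    also have "\<dots> = group_det G ?u * group_det H f ^ n"
      by (simp only: w(2))
    finally have *: "int \<alpha> ^ card (carrier H) * group_det G (\<lambda>x. ?u x + w (h x)) =
        group_det G ?u * group_det H f ^ n" .
    have "int \<alpha> ^ card (carrier H) * \<bar>group_det G (\<lambda>x. ?u x + w (h x))\<bar> =
        int \<alpha> ^ card (carrier H) * int \<alpha> ^ n"
      using group_det_geometric[OF \<alpha>(1) prime_gt_1_nat[OF assms(1)]] f(2)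
      arg_cong[OF *, of abs] by (simp add: abs_mult power_abs)
    then show ?thesis using \<alpha>(2) by simp
  qed
  ultimately show ?thesis by blast
qed

end

section \<open>The tower of quotients of the Heisenberg group\<close>

definition cyclic :: "nat \<Rightarrow> nat monoid" where
  "cyclic n = \<lparr>carrier = {..<n}, mult = (\<lambda>a b. (a + b) mod n), one = 0\<rparr>"

lemma cyclic_sel [simp]:
  "carrier (cyclic n) = {..<n}"
  "a \<otimes>\<^bsub>cyclic n\<^esub> b = (a + b) mod n"
  "\<one>\<^bsub>cyclic n\<^esub> = 0"
  by (simp_all add: cyclic_def)

lemma group_cyclic:
  assumes "n > 0"
  shows "group (cyclic n)"
proof (rule groupI)
  fix a assume "a \<in> carrier (cyclic n)"
  then show "\<exists>b\<in>carrier (cyclic n). b \<otimes>\<^bsub>cyclic n\<^esub> a = \<one>\<^bsub>cyclic n\<^esub>"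
    by (intro bexI[of _ "(n - a) mod n"]) (auto simp: mod_add_left_eq)
qed (use assms in \<open>auto simp: mod_simps add.assoc\<close>)

lemma cyclic_pow: "a [^]\<^bsub>cyclic n\<^esub> (k::nat) = k * a mod n"
  by (induction k) (simp_all add: nat_pow_def mod_simps add.commute)

lemma DirProd_pow: "(a, b) [^]\<^bsub>G \<times>\<times> H\<^esub> (k::nat) = (a [^]\<^bsub>G\<^esub> k, b [^]\<^bsub>H\<^esub> k)"
  by (induction k) (simp_all add: nat_pow_def)


lemma group_hom_to_trivial:
  assumes "group G"
  shows "group_hom G (cyclic 1) (\<lambda>_. 0)"
  using assms group_cyclic[of 1] by (intro group_hom.intro group_hom_axioms.intro) (auto simp: hom_def)

lemma finite_group_epi_trivial:
  assumes "group G" "finite (carrier G)"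
  shows "finite_group_epi G (cyclic 1) (\<lambda>_. 0)"
  using group_hom_to_trivial[OF assms(1)] assms(2) monoid.one_closed[OF group.is_monoid[OF assms(1)]]
  by (intro finite_group_epi.intro finite_group_epi_axioms.intro) auto

text \<open>Bottom of the tower: over the trivial group \<open>cyclic 1\<close> the kernel is
  everything and |H| = 1, so 1 + z + ... + z^(a-1) already has determinant a up to sign.\<close>

lemma exists_group_det_cyclic:
  assumes "p > 1" "coprime a p"
  shows "\<exists>f. (\<Sum>x\<in>carrier (cyclic p). f x) = int a \<and> \<bar>group_det (cyclic p) f\<bar> = int a"
proof -
  have ker: "kernel (cyclic p) (cyclic 1) (\<lambda>_. 0) = {..<p}"
    by (auto simp: kernel_def)
  have "kernel (cyclic p) (cyclic 1) (\<lambda>_. 0) = (\<lambda>i::nat. 1 [^]\<^bsub>cyclic p\<^esub> i) ` {..<p}"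
    unfolding ker by (simp add: cyclic_pow)
  then have "cyclic_kernel (cyclic p) (cyclic 1) (\<lambda>_. 0) 1 p"
    using assms group_cyclic[of p]
    by (intro cyclic_kernel.intro cyclic_kernel_axioms.intro finite_group_epi_trivial)
      (simp_all add: cyclic_pow ker)
  from cyclic_kernel.group_det_geometric[OF this assms(2,1)] cyclic_kernel.sum_push_geometric[OF this, of a]
  show ?thesis by (intro exI conjI) simp_all
qed

lemma exists_group_det_cyclic_square:
  assumes "prime p" "\<not> p dvd a"
  shows "\<exists>f. (\<Sum>x\<in>carrier (cyclic p \<times>\<times> cyclic p). f x) = int (a ^ p) \<and>
    \<bar>group_det (cyclic p \<times>\<times> cyclic p) f\<bar> = int (a ^ p)"
proof -
  have p: "p > 1" using prime_gt_1_nat[OF assms(1)] .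
  then have grp: "group (cyclic p)" by (intro group_cyclic) simp
  have ker: "kernel (cyclic p \<times>\<times> cyclic p) (cyclic p) snd = (\<lambda>i. (i, 0)) ` {..<p}"
    using p by (auto simp: kernel_def image_iff)
  interpret finite_group_epi "cyclic p \<times>\<times> cyclic p" "cyclic p" snd
    using p by (intro finite_group_epi.intro finite_group_epi_axioms.intro group_hom.intro
        group_hom_axioms.intro DirProd_group grp) (auto simp: hom_def)
  interpret cyclic_kernel "cyclic p \<times>\<times> cyclic p" "cyclic p" snd "(1, 0)" p
  proof unfold_locales
    show "kernel (cyclic p \<times>\<times> cyclic p) (cyclic p) snd =
        (\<lambda>i::nat. (1, 0) [^]\<^bsub>cyclic p \<times>\<times> cyclic p\<^esub> i) ` {..<p}"
      unfolding ker by (intro image_cong) (simp_all add: cyclic_pow DirProd_pow)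
  qed (use p in \<open>simp_all add: cyclic_pow DirProd_pow ker card_image inj_on_def\<close>)
  \<comment> \<open>This presents the group ring of Z_p as an image of Z[X].\<close>
  interpret \<phi>: monoid_algebra_hom "cyclic p" "\<lambda>i. i mod p"
    using grp p by (intro monoid_algebra_hom.intro monoid_algebra_hom_axioms.intro) (auto simp: mod_simps)
  obtain f where "(\<Sum>x\<in>carrier (cyclic p). f x) = int a" "\<bar>group_det (cyclic p) f\<bar> = int a"
    using exists_group_det_cyclic[OF p, of a] prime_imp_coprime[OF assms] by (auto simp: coprime_commute)
  moreover have "carrier (cyclic p) \<subseteq> range (\<lambda>i. i mod p)"
  proof
    fix y assume "y \<in> carrier (cyclic p)"
    then show "y \<in> range (\<lambda>i. i mod p)" by (intro range_eqI[of _ _ y]) simp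
  qed
  ultimately show ?thesis
    using assms by (intro exists_group_det_power[OF assms(1) \<phi>.monoid_algebra_hom_axioms])
      (auto simp: cyclic_pow)
qed

text \<open>Dividing by the central subgroup generated by z leaves Z_p x Z_p. Only this quotient has
  to be commutative of exponent p.\<close>

lemma exists_group_det_heisenberg:
  assumes "prime p" "\<not> p dvd a"
  shows "\<exists>f. (\<Sum>x\<in>carrier (heisenberg p). f x) = int (a ^ p ^ 2) \<and>
    \<bar>group_det (heisenberg p) f\<bar> = int (a ^ p ^ 2)"
proof -
  let ?\<pi> = "\<lambda>(a, b, c). (a, b)"
  have p: "p > 1" using prime_gt_1_nat[OF assms(1)] .
  then have grp: "group (cyclic p)" by (intro group_cyclic) simp
  have hgrp: "group (heisenberg p)" using p by (intro group_heisenberg) simp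
  have ker: "kernel (heisenberg p) (cyclic p \<times>\<times> cyclic p) ?\<pi> = (\<lambda>i. (0, 0, i)) ` {..<p}"
    using p by (auto simp: kernel_def image_iff heisenberg_sel)
  interpret finite_group_epi "heisenberg p" "cyclic p \<times>\<times> cyclic p" ?\<pi>
  proof (intro finite_group_epi.intro finite_group_epi_axioms.intro group_hom.intro
        group_hom_axioms.intro DirProd_group grp hgrp)
    show "?\<pi> \<in> hom (heisenberg p) (cyclic p \<times>\<times> cyclic p)"
      by (auto simp: hom_def heisenberg_sel)
    show "finite (carrier (heisenberg p))" by (simp add: heisenberg_sel)
    show "?\<pi> ` carrier (heisenberg p) = carrier (cyclic p \<times>\<times> cyclic p)"
      using p by (force simp: heisenberg_sel)
  qed
  interpret cyclic_kernel "heisenberg p" "cyclic p \<times>\<times> cyclic p" ?\<pi> heis_z p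
  proof unfold_locales
    show "kernel (heisenberg p) (cyclic p \<times>\<times> cyclic p) ?\<pi> =
        (\<lambda>i::nat. heis_z [^]\<^bsub>heisenberg p\<^esub> i) ` {..<p}"
      unfolding ker by (intro image_cong) (simp_all add: heis_pow(3)[OF p])
  qed (use p in \<open>simp_all add: heisenberg_relations(3,6)[OF p] ker card_image inj_on_def\<close>)
  \<comment> \<open>Exponent pairs: the group ring of the quotient is an image of the polynomial
    ring in two variables.\<close>
  interpret \<phi>: monoid_algebra_hom "cyclic p \<times>\<times> cyclic p" "\<lambda>(i, j). (i mod p, j mod p)"
    using p by (intro monoid_algebra_hom.intro monoid_algebra_hom_axioms.intro DirProd_group grp)
      (auto simp: mod_simps zero_prod_def)
  obtain f where "(\<Sum>x\<in>carrier (cyclic p \<times>\<times> cyclic p). f x) = int (a ^ p)"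
    "\<bar>group_det (cyclic p \<times>\<times> cyclic p) f\<bar> = int (a ^ p)"
    using exists_group_det_cyclic_square[OF assms] by auto
  moreover have "carrier (cyclic p \<times>\<times> cyclic p) \<subseteq> range (\<lambda>(i, j). (i mod p, j mod p))"
  proof
    fix y assume "y \<in> carrier (cyclic p \<times>\<times> cyclic p)"
    then show "y \<in> range (\<lambda>(i, j). (i mod p, j mod p))"
      by (intro range_eqI[of _ _ y]) auto
  qed
  \<comment> \<open>The second climb starts from a^p, so coprimality to p must be renewed.\<close>
  moreover have "\<not> p dvd a ^ p" using assms prime_dvd_power by blast
  ultimately have "\<exists>f'. (\<Sum>x\<in>carrier (heisenberg p). f' x) = int ((a ^ p) ^ p) \<and>
      \<bar>group_det (heisenberg p) f'\<bar> = int ((a ^ p) ^ p)"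
    by (intro exists_group_det_power[OF assms(1) \<phi>.monoid_algebra_hom_axioms])
      (auto simp: cyclic_pow DirProd_pow)
  then show ?thesis by (simp add: power2_eq_square power_mult)
qed

text \<open>A constant function is lifted from the trivial group, where \<open>f\<close> becomes the
  scalar \<alpha>; the lifting formula applies with kernel \<open>G\<close>.\<close>

lemma group_det_add_const:
  fixes f :: "'g \<Rightarrow> int"
  assumes "group G" "finite (carrier G)" "(\<Sum>x\<in>carrier G. f x) = \<alpha>" "\<alpha> \<noteq> 0"
  shows "\<alpha> * group_det G (\<lambda>x. f x + c) = group_det G f * (\<alpha> + int (card (carrier G)) * c)"
proof -
  let ?n = "card (carrier G)"
  have "group_det (cyclic 1) (\<lambda>y. (if y = \<one>\<^bsub>cyclic 1\<^esub> then \<alpha> else 0) + int ?n * c) =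
      group_det (cyclic 1) (\<lambda>y. if y = \<one>\<^bsub>cyclic 1\<^esub> then \<alpha> + int ?n * c else 0)"
    by (rule group_det_cong) (use group_cyclic[of 1] in auto)
  also have "\<dots> = \<alpha> + int ?n * c"
    using group_det_scalar[of "cyclic 1" "\<alpha> + int ?n * c"] group_cyclic[of 1] by simp
  finally have *: "group_det (cyclic 1) (\<lambda>y. (if y = \<one>\<^bsub>cyclic 1\<^esub> then \<alpha> else 0) + int ?n * c) = \<alpha> + int ?n * c" .
  have "kernel G (cyclic 1) (\<lambda>_. 0) = carrier G" by (auto simp: kernel_def)
  then show ?thesis
    using finite_group_epi.group_det_add_lift[OF finite_group_epi_trivial[OF assms(1,2)], of f \<alpha> "\<lambda>_. c"]
      assms(3,4) * by simp
qed

theorem theorem3: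
  fixes p a :: nat and m :: int
  assumes "prime p" and "p \<ge> 3" and "\<not> p dvd a"
  shows "\<exists>A :: nat \<Rightarrow> nat \<Rightarrow> nat \<Rightarrow> int.
    group_det (heisenberg p) (heis_elem p A) = int a ^ (p ^ 2) + m * int p ^ 3"
proof -
  define \<alpha> where "\<alpha> = int (a ^ p ^ 2)"
  have p: "p > 1" using assms(2) by simp
  have grp: "group (heisenberg p)" using p by (intro group_heisenberg) simp
  have fin: "finite (carrier (heisenberg p))" by (simp add: heisenberg_sel)
  have \<alpha>: "\<alpha> \<noteq> 0" using assms(3) by (cases "a = 0") (simp_all add: \<alpha>_def)
  obtain f where f: "(\<Sum>x\<in>carrier (heisenberg p). f x) = \<alpha>" "\<bar>group_det (heisenberg p) f\<bar> = \<alpha>"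
    using exists_group_det_heisenberg[OF assms(1,3)] by (auto simp: \<alpha>_def)
  define s where "s = sgn (group_det (heisenberg p) f)"
  have s: "group_det (heisenberg p) f = s * \<alpha>" "s = 1 \<or> s = -1"
    using f(2) \<alpha> by (auto simp: s_def sgn_if)
  have "\<alpha> * group_det (heisenberg p) (\<lambda>x. f x + m) = \<alpha> * (s * (\<alpha> + m * int p ^ 3))"
    using group_det_add_const[OF grp fin f(1) \<alpha>, of m] s(1) by (simp add: card_heisenberg algebra_simps)
  then have det: "group_det (heisenberg p) (\<lambda>x. f x + m) = s * (\<alpha> + m * int p ^ 3)"
    using \<alpha> by simp
  \<comment> \<open>The order p^3 is odd, so multiplying the element by \<open>s\<close> multiplies
    the determinant by \<open>s\<close>.\<close>
  have "odd p" using assms(1,2) prime_odd_nat by simp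
  then have "group_det (heisenberg p) (\<lambda>x. s * (f x + m)) = \<alpha> + m * int p ^ 3"
    using s(2) det group_det_uminus[OF fin, of "\<lambda>x. f x + m"] by (auto simp: card_heisenberg)
  \<comment> \<open>By the normal form, x^i y^j z^k is the triple (i, j, k), so any function on the
    carrier arises from coefficients \<open>A i j k\<close>.\<close>
  moreover have "group_det (heisenberg p) (heis_elem p (\<lambda>i j k. s * (f (i, j, k) + m))) =
      group_det (heisenberg p) (\<lambda>x. s * (f x + m))"
    using p by (intro group_det_cong grp fin) (auto simp: heisenberg_sel heis_elem_apply)
  ultimately show ?thesis
    by (intro exI[of _ "\<lambda>i j k. s * (f (i, j, k) + m)"]) (simp add: \<alpha>_def)
qed

end
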